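(* Let $h_2(x)=x^2-1$. Then $$\mathcal{L}_2=\Big\{\Lambda\in\mathcal{K}_2:\ \Lambda(0,\cdot)=\Lambda(1,\cdot)=\gamma,\ \Lambda(2,dx)=\big(1+\tfrac{a_2}{2}h_2(x)\big)\gamma(dx)\ \text{for some } a_2\in[0,2]\Big\}$$ and $$\mathcal{L}_3=\Big\{\Lambda\in\mathcal{K}_3:\ \Lambda(0,\cdot)=\Lambda(1,\cdot)=\gamma,\ \Lambda(2,dx)=\big(1+\tfrac{a_2}{2}h_2(x)\big)\gamma(dx),\ \Lambda(3,dx)=\big(1+\tfrac{3a_2}{2}h_2(x)\big)\gamma(dx)\ \text{for some } a_2\in[0,\tfrac23]\Big\}.$$
   Context: For an integer $N\ge 0$, the Yule (pure-death) generator $D_N$ acts on functions on $\{0,\dots,N\}$ by $D_N[f](x)=x\,(f(x-1)-f(x))$ (equal to $0$ at $x=0$). The Ornstein-Uhlenbeck operator $L$ acts on the space $\mathcal{P}$ of polynomial functions on $\mathbb{R}$ by $L[f](x)=f''(x)-xf'(x)$. $\gamma$ is the standard normal distribution. $\mathcal{K}_N$ is the set of Markov kernels $\Lambda$ from $\{0,\dots,N\}$ to $\mathbb{R}$ (i.e. families of Borel probability measures $\Lambda(y,\cdot)$ on $\mathbb{R}$) such that $\int\exp(x^2/4)\,\Lambda(y,dx)<\infty$ for all $y\in\{0,\dots,N\}$. With $\Lambda[f](y)=\int f(x)\,\Lambda(y,dx)$, $$\mathcal{L}_N=\{\Lambda\in\mathcal{K}_N:\ D_N[\Lambda[f]]=\Lambda[L[f]]\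 \text{for all } f\in\mathcal{P}\}.$$ *)

theory Defs
  imports "HOL-Probability.Probability"
begin

text \<open>
  Functions on \<open>{0..N}\<close> are modelled as extensional functions on \<open>nat\<close> (fixed to
  \<open>undefined\<close> outside \<open>{0..N}\<close>), so that HOL equality is equality of functions on \<open>{0..N}\<close>.
\<close>

text \<open>The truncated \<open>x - 1\<close> at \<open>x = 0\<close> is harmless because of the factor \<open>x\<close>.\<close>

definition yule_generator :: "nat \<Rightarrow> (nat \<Rightarrow> real) \<Rightarrow> nat \<Rightarrow> real" where
  "yule_generator N f = (\<lambda>x\<in>{0..N}. real x * (f (x - 1) - f x))"

definition polynomial_functions :: "(real \<Rightarrow> real) set" where
  "polynomial_functions = range poly"

definition OU_operator :: "(real \<Rightarrow> real) \<Rightarrow> real \<Rightarrow> real" where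
  "OU_operator f x = deriv (deriv f) x - x * deriv f x"

definition std_gaussian :: "real measure" where
  "std_gaussian = density lborel std_normal_density"

text \<open>
  On the finite (discrete) source space \<open>{0..N}\<close> the measurability requirement on a Markov
  kernel is vacuous, so a kernel is just a family of Borel probability measures.
\<close>

definition markov_kernels :: "nat \<Rightarrow> (nat \<Rightarrow> real measure) set" where
  "markov_kernels N = {0..N} \<rightarrow>\<^sub>E {\<mu>. prob_space \<mu> \<and> sets \<mu> = sets borel}"

definition kernels_K :: "nat \<Rightarrow> (nat \<Rightarrow> real measure) set" where
  "kernels_K N = {\<Lambda> \<in> markov_kernels N. \<forall>y\<in>{0..N}. (\<integral>\<^sup>+ x. ennreal (exp (x\<^sup>2 / 4)) \<partial>\<Lambda> y) < \<infinity>}"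

definition kernel_op :: "nat \<Rightarrow> (nat \<Rightarrow> real measure) \<Rightarrow> (real \<Rightarrow> real) \<Rightarrow> nat \<Rightarrow> real" where
  "kernel_op N \<Lambda> f = (\<lambda>y\<in>{0..N}. \<integral>x. f x \<partial>\<Lambda> y)"

definition kernels_L :: "nat \<Rightarrow> (nat \<Rightarrow> real measure) set" where
  "kernels_L N = {\<Lambda> \<in> kernels_K N. \<forall>f\<in>polynomial_functions.
     yule_generator N (kernel_op N \<Lambda> f) = kernel_op N \<Lambda> (OU_operator f)}"

definition h2 :: "real \<Rightarrow> real" where
  "h2 x = x\<^sup>2 - 1"

text \<open>
  The measure \<open>(1 + c h\<^sub>2(x)) \<gamma>(dx)\<close>. The coercion \<open>ennreal\<close> truncates negative values; for
  \<open>0 \<le> c \<le> 1\<close> the density is nonnegative and nothing is truncated.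
\<close>

definition h2_tilted_gaussian :: "real \<Rightarrow> real measure" where
  "h2_tilted_gaussian c = density std_gaussian (\<lambda>x. ennreal (1 + c * h2 x))"

end

theory Submission
  imports Defs "HOL-Real_Asymp.Real_Asymp"
begin

text \<open>
  Tested on \<open>x\<^sup>k\<close>, the intertwining relation reads
  \<open>(k - y) m\<^sub>y(k) = k (k - 1) m\<^sub>y(k - 2) - y m\<^sub>y\<^sub>-\<^sub>1(k)\<close> for the moments \<open>m\<^sub>y\<close> of
  \<open>\<Lambda>(y, _)\<close>, so they are determined by those of \<open>\<Lambda>(y - 1, _)\<close> up to the single free
  value \<open>m\<^sub>y(y)\<close>. For \<open>y \<le> 3\<close> the solutions are the moments of \<open>p \<gamma>\<close>, where \<open>p\<close> is
  a combination of Hermite polynomials. The exponential moments make the moment problem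
  determinate, hence \<open>\<Lambda>(y, _) = p \<gamma>\<close> and \<open>p \<ge> 0\<close>; nonnegativity kills the odd Hermite
  components and bounds the coefficient of \<open>h\<^sub>2\<close>.
\<close>

section \<open>Characteristic functions as moment series\<close>

lemma power_div_fact_le_exp:
  fixes x :: real
  assumes "0 \<le> x"
  shows "x ^ n / fact n \<le> exp x"
proof -
  have "(\<Sum>k\<in>{n}. x ^ k /\<^sub>R fact k) \<le> (\<Sum>k. x ^ k /\<^sub>R fact k)"
    using assms by (intro sum_le_suminf summable_exp_generic) auto
  then show ?thesis
    by (simp add: exp_def divide_inverse mult.commute)
qed

text \<open>\<open>char_approx1\<close> bounds the Taylor remainder by 2 |t|^n / n! times the n-th
  absolute moment; exponential moments of every order make this decay geometrically, so the
  expansion holds for every t and not only near 0.\<close>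

lemma char_sums_moments:
  assumes "real_distribution M" and exp_int: "\<And>s. integrable M (\<lambda>x. exp (s * \<bar>x\<bar>))"
  shows "(\<lambda>k. (\<i> * t) ^ k / fact k * (\<integral>x. x ^ k \<partial>M)) sums char M t"
proof -
  interpret real_distribution M by fact
  have pw: "\<bar>x\<bar> ^ n \<le> fact n * exp (1 * \<bar>x\<bar>)" for n and x :: real
    using power_div_fact_le_exp[of "\<bar>x\<bar>" n] by (simp add: field_simps)
  have mom: "integrable M (\<lambda>x. x ^ n)" for n
    by (rule Bochner_Integration.integrable_bound[OF integrable_mult_right[OF exp_int[of 1], of "fact n"]])
       (use pw in \<open>auto simp: power_abs\<close>)
  \<comment> \<open>The factor 2 yields the geometric gain: |tx|^n / n! = 2^(-n) (2|tx|)^n / n!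
    \<le> 2^(-n) exp(2|tx|).\<close>
  define C where "C = expectation (\<lambda>x. exp ((2 * \<bar>t\<bar>) * \<bar>x\<bar>))"
  have bound: "cmod (char M t - (\<Sum>k\<le>n. (\<i> * t) ^ k / fact k * expectation (\<lambda>x. x ^ k))) \<le> 2 * C * (1 / 2) ^ n" for n
  proof -
    have "\<bar>t\<bar> ^ n / fact n * expectation (\<lambda>x. \<bar>x\<bar> ^ n) = expectation (\<lambda>x. \<bar>t\<bar> ^ n / fact n * \<bar>x\<bar> ^ n)"
      by simp
    also have "\<dots> \<le> expectation (\<lambda>x. (1 / 2) ^ n * exp ((2 * \<bar>t\<bar>) * \<bar>x\<bar>))"
    proof (rule integral_mono)
      show "integrable M (\<lambda>x. \<bar>t\<bar> ^ n / fact n * \<bar>x\<bar> ^ n)"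
        using integrable_abs[OF mom[of n]] by (simp add: power_abs)
      show "integrable M (\<lambda>x. (1 / 2) ^ n * exp ((2 * \<bar>t\<bar>) * \<bar>x\<bar>))"
        by (intro integrable_mult_right exp_int)
      fix x :: real
      show "\<bar>t\<bar> ^ n / fact n * \<bar>x\<bar> ^ n \<le> (1 / 2) ^ n * exp ((2 * \<bar>t\<bar>) * \<bar>x\<bar>)"
        using power_div_fact_le_exp[of "(2 * \<bar>t\<bar>) * \<bar>x\<bar>" n]
        by (simp add: power_mult_distrib field_simps)
    qed
    finally have "\<bar>t\<bar> ^ n / fact n * expectation (\<lambda>x. \<bar>x\<bar> ^ n) \<le> (1 / 2) ^ n * C"
      by (simp add: C_def)
    then show ?thesis
      by (intro order.trans[OF char_approx1[OF mom]]) (simp add: field_simps)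
  qed
  have "(\<lambda>n. 2 * C * (1 / 2) ^ n) \<longlonglongrightarrow> 0"
    by (intro tendsto_mult_right_zero LIMSEQ_power_zero) simp
  then have "(\<lambda>n. char M t - (\<Sum>k\<le>n. (\<i> * t) ^ k / fact k * expectation (\<lambda>x. x ^ k))) \<longlonglongrightarrow> 0"
    by (rule Lim_null_comparison[rotated]) (use bound in auto)
  from tendsto_diff[OF tendsto_const[of "char M t"] this] show ?thesis
    by (simp add: sums_def_le)
qed

section \<open>Mixtures of two real distributions\<close>

text \<open>The measure q M + (1 - q) N, written as a Bernoulli draw followed by M or N, so that the
  rules for the monadic bind supply its measure and integrals.\<close>

definition mixture :: "real \<Rightarrow> real measure \<Rightarrow> real measure \<Rightarrow> real measure" where
  "mixture q M N = measure_pmf (bernoulli_pmf q) \<bind> (\<lambda>b. if b then M else N)"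

context
  fixes q :: real and M N :: "real measure"
  assumes q: "0 \<le> q" "q \<le> 1" and M: "real_distribution M" and N: "real_distribution N"
begin

lemma mixture_kernel_measurable:
  "(\<lambda>b. if b then M else N) \<in> measure_pmf (bernoulli_pmf q) \<rightarrow>\<^sub>M subprob_algebra borel"
  using M N
  by (auto simp: space_subprob_algebra real_distribution_def real_distribution_axioms_def
      intro: prob_space_imp_subprob_space split: if_splits)

lemma emeasure_mixture:
  assumes "A \<in> sets borel"
  shows "emeasure (mixture q M N) A = emeasure M A * q + emeasure N A * (1 - q)"
  unfolding mixture_def
  by (subst emeasure_bind[OF _ mixture_kernel_measurable assms]) (use q in auto)

lemma real_distribution_mixture: "real_distribution (mixture q M N)"
proof -
  interpret M: real_distribution M by (rule M)
  interpret N: real_distribution N by (rule N)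
  have sets: "sets (mixture q M N) = sets borel"
    unfolding mixture_def by (rule sets_bind) (use M N in \<open>auto simp: real_distribution_def real_distribution_axioms_def\<close>)
  have "emeasure (mixture q M N) UNIV = 1"
    using M.emeasure_space_1 N.emeasure_space_1 q
    by (simp add: emeasure_mixture ennreal_plus[symmetric] del: ennreal_plus)
  then show ?thesis
    using sets sets_eq_imp_space_eq[OF sets]
    by (intro real_distribution.intro prob_spaceI real_distribution_axioms.intro) auto
qed

lemma integral_mixture:
  fixes f :: "real \<Rightarrow> real"
  assumes "f \<in> borel_measurable borel" "\<And>x. \<bar>f x\<bar> \<le> B"
  shows "(\<integral>x. f x \<partial>mixture q M N) = q * (\<integral>x. f x \<partial>M) + (1 - q) * (\<integral>x. f x \<partial>N)"
proof -
  interpret M: real_distribution M by (rule M)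
  interpret N: real_distribution N by (rule N)
  show ?thesis
    unfolding mixture_def
    by (subst integral_bind[OF assms(1) _ mixture_kernel_measurable, where B = B and B' = 1])
       (use assms q M.emeasure_space_1 N.emeasure_space_1 in \<open>auto simp: measure_pmf.finite_measure mult.commute\<close>)
qed

lemma char_mixture: "char (mixture q M N) t = q * char M t + (1 - q) * char N t"
proof -
  interpret M: real_distribution M by (rule M)
  interpret N: real_distribution N by (rule N)
  interpret X: real_distribution "mixture q M N" by (rule real_distribution_mixture)
  \<comment> \<open>\<open>integral_mixture\<close> covers bounded real integrands, so the
    characteristic function is split into its cosine and sine integrals.\<close>
  have *: "char R t = Complex (\<integral>x. cos (t * x) \<partial>R) (\<integral>x. sin (t * x) \<partial>R)"
    if "real_distribution R" for R
  proof -
    interpret real_distribution R by fact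
    have "integrable R (\<lambda>x. iexp (t * x))"
      by (intro integrable_const_bound) auto
    then show ?thesis
      unfolding char_def
      by (intro complex_eqI) (simp_all add: Re_exp Im_exp flip: integral_Re integral_Im)
  qed
  show ?thesis
    unfolding *[OF M] *[OF N] *[OF real_distribution_mixture]
    by (intro complex_eqI) (auto intro!: integral_mixture[where B = 1])
qed

end


section \<open>Integrability from the moment of exp(x^2/4)\<close>

text \<open>The growth is absorbed in two moves: |x|^k \<le> k! exp |x|, and then the linear
  exponent is dominated by x^2/4 plus a constant.\<close>

lemma integrable_power_mult_exp_abs:
  assumes [measurable_cong]: "sets M = sets borel" and int: "integrable M (\<lambda>x. exp (x\<^sup>2 / 4))"
  shows "integrable M (\<lambda>x::real. x ^ k * exp (s * \<bar>x\<bar>))"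
proof (rule Bochner_Integration.integrable_bound)
  show "integrable M (\<lambda>x. (fact k * exp ((s + 1)\<^sup>2)) * exp (x\<^sup>2 / 4))"
    by (intro integrable_mult_right int)
  show "(\<lambda>x. x ^ k * exp (s * \<bar>x\<bar>)) \<in> borel_measurable M"
    by measurable
  have "\<bar>x\<bar> ^ k * exp (s * \<bar>x\<bar>) \<le> fact k * exp ((s + 1)\<^sup>2) * exp (x\<^sup>2 / 4)" for x :: real
  proof -
    have "\<bar>x\<bar> ^ k \<le> fact k * exp \<bar>x\<bar>"
      using power_div_fact_le_exp[of "\<bar>x\<bar>" k] by (simp add: field_simps)
    then have "\<bar>x\<bar> ^ k * exp (s * \<bar>x\<bar>) \<le> fact k * exp \<bar>x\<bar> * exp (s * \<bar>x\<bar>)"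
      by (intro mult_right_mono) auto
    also have "\<dots> = fact k * exp ((s + 1) * \<bar>x\<bar>)"
      by (simp add: algebra_simps flip: exp_add)
    \<comment> \<open>Expand (s + 1 - |x|/2)^2 \<ge> 0.\<close>
    also have "(s + 1) * \<bar>x\<bar> \<le> (s + 1)\<^sup>2 + x\<^sup>2 / 4"
      using zero_le_power2[of "s + 1 - \<bar>x\<bar> / 2"] by (simp add: power2_diff power_divide algebra_simps)
    finally show ?thesis
      by (simp add: exp_add mult.assoc)
  qed
  then show "AE x in M. norm (x ^ k * exp (s * \<bar>x\<bar>)) \<le> norm (fact k * exp ((s + 1)\<^sup>2) * exp (x\<^sup>2 / 4))"
    by (simp add: power_abs abs_mult)
qed

lemma sets_std_gaussian [measurable_cong, simp]: "sets std_gaussian = sets borel"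
  by (simp add: std_gaussian_def)

lemma real_distribution_std_gaussian: "real_distribution std_gaussian"
  using prob_space_normal_density[of 1 0]
  by (auto simp: std_gaussian_def real_distribution_def real_distribution_axioms_def)

lemma integrable_std_gaussian_exp_square: "integrable std_gaussian (\<lambda>x. exp (x\<^sup>2 / 4))"
proof -
  \<comment> \<open>The exponent -x^2/2 + x^2/4 = -x^2/4 belongs to variance 2;
    \<open>sqrt 2\<close> corrects the normalising constant.\<close>
  have "std_normal_density x * exp (x\<^sup>2 / 4) = sqrt 2 * normal_density 0 (sqrt 2) x" for x
    by (simp add: normal_density_def real_sqrt_mult field_simps flip: exp_add)
  then have "integrable lborel (\<lambda>x. std_normal_density x * exp (x\<^sup>2 / 4))"
    by (simp add: integrable_mult_right)
  then show ?thesis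
    unfolding std_gaussian_def by (subst integrable_density) auto
qed

lemma integrable_poly_mult_exp_abs:
  assumes "sets M = sets borel" "integrable M (\<lambda>x. exp (x\<^sup>2 / 4))"
  shows "integrable M (\<lambda>x::real. poly p x * exp (s * \<bar>x\<bar>))"
  using integrable_power_mult_exp_abs[OF assms]
  by (simp add: poly_altdef sum_distrib_right mult.assoc)

lemma integrable_poly:
  assumes "sets M = sets borel" "integrable M (\<lambda>x. exp (x\<^sup>2 / 4))"
  shows "integrable M (poly p :: real \<Rightarrow> real)"
  using integrable_poly_mult_exp_abs[OF assms, of p 0] by simp

lemma integrable_power:
  assumes "sets M = sets borel" "integrable M (\<lambda>x. exp (x\<^sup>2 / 4))"
  shows "integrable M (\<lambda>x::real. x ^ k)"
  using integrable_power_mult_exp_abs[OF assms, of k 0] by simp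

lemma borel_measurable_poly [measurable]: "(poly p :: real \<Rightarrow> real) \<in> borel_measurable borel"
  by (intro borel_measurable_continuous_onI continuous_intros)

lemmas std_gaussian_integrable_poly [simp] =
  integrable_poly[OF sets_std_gaussian integrable_std_gaussian_exp_square]

lemma std_gaussian_integrable_power_mult_poly:
  "integrable std_gaussian (\<lambda>x. x ^ k * poly p x)"
proof -
  have "(\<lambda>x. x ^ k * poly p x) = poly (monom 1 k * p)"
    by (simp add: fun_eq_iff poly_monom)
  then show ?thesis
    by simp
qed

lemma std_gaussian_integrable_indicator_mult_poly:
  "A \<in> sets borel \<Longrightarrow> integrable std_gaussian (\<lambda>x. indicator A x * poly p x)"
  using integrable_mult_indicator[of A std_gaussian "poly p"] by simp

section \<open>Probability measures with polynomial Gaussian density\<close>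

definition gaussian_mass :: "real poly \<Rightarrow> real" where
  "gaussian_mass q = (\<integral>x. poly q x \<partial>std_gaussian)"

definition poly_gaussian :: "real poly \<Rightarrow> real measure" where
  "poly_gaussian q = density std_gaussian (\<lambda>x. ennreal (poly q x / gaussian_mass q))"

text \<open>The lower bound 1 keeps the density nonnegative and the normalising mass away from
  0.\<close>

context
  fixes q :: "real poly"
  assumes q: "\<And>x. 1 \<le> poly q x"
begin

lemma gaussian_mass_ge_1: "1 \<le> gaussian_mass q"
proof -
  interpret real_distribution std_gaussian by (rule real_distribution_std_gaussian)
  show ?thesis
    unfolding gaussian_mass_def by (rule integral_ge_const) (use q in auto)
qed

lemma poly_gaussian_density_nonneg: "0 \<le> poly q x / gaussian_mass q"
  using q[of x] gaussian_mass_ge_1 by simp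

lemma integral_poly_gaussian:
  fixes f :: "real \<Rightarrow> real"
  assumes "f \<in> borel_measurable borel"
  shows "(\<integral>x. f x \<partial>poly_gaussian q) = (\<integral>x. f x * poly q x \<partial>std_gaussian) / gaussian_mass q"
  unfolding poly_gaussian_def
  by (subst integral_density) (use assms poly_gaussian_density_nonneg in \<open>auto simp: mult.commute\<close>)

lemma real_distribution_poly_gaussian: "real_distribution (poly_gaussian q)"
proof -
  have "emeasure (poly_gaussian q) UNIV = (\<integral>\<^sup>+x. ennreal (poly q x / gaussian_mass q) \<partial>std_gaussian)"
    by (simp add: poly_gaussian_def emeasure_density)
  also have "\<dots> = ennreal (\<integral>x. poly q x / gaussian_mass q \<partial>std_gaussian)"
    by (rule nn_integral_eq_integral) (use poly_gaussian_density_nonneg in auto)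
  also have "(\<integral>x. poly q x / gaussian_mass q \<partial>std_gaussian) = 1"
    using gaussian_mass_ge_1 by (simp add: gaussian_mass_def)
  finally show ?thesis
    by (intro real_distribution.intro prob_spaceI real_distribution_axioms.intro)
       (simp_all add: poly_gaussian_def std_gaussian_def)
qed

lemma integrable_poly_gaussian_exp_abs: "integrable (poly_gaussian q) (\<lambda>x. exp (s * \<bar>x\<bar>))"
proof -
  have "integrable std_gaussian (\<lambda>x. poly q x * exp (s * \<bar>x\<bar>) / gaussian_mass q)"
    by (intro integrable_divide integrable_poly_mult_exp_abs integrable_std_gaussian_exp_square) simp
  then show ?thesis
    unfolding poly_gaussian_def
    by (subst integrable_density) (use poly_gaussian_density_nonneg in auto)
qed

end

section \<open>Moment determinacy for polynomial Gaussian densities\<close>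

text \<open>The normal density is positive, so the inequality holds Lebesgue-almost everywhere; a
  closed set of full Lebesgue measure is the whole line.\<close>

lemma poly_nonneg_of_AE_std_gaussian:
  assumes "AE x in std_gaussian. 0 \<le> poly p x"
  shows "0 \<le> poly p x"
proof -
  have "closed {x. 0 \<le> poly p x}"
    by (intro closed_Collect_le continuous_intros)
  moreover have "AE x in lborel. 0 \<le> poly p x"
    using assms unfolding std_gaussian_def
    by (subst (asm) AE_density) (auto simp: normal_density_pos)
  then have "AE x in lebesgue. x \<in> {x. 0 \<le> poly p x}"
    by (auto intro: AE_completion)
  ultimately show ?thesis
    using mem_closed_if_AE_lebesgue by blast
qed

text \<open>
  Since \<open>p\<close> may a priori change sign, \<open>(2 + p\<^sup>2) \<gamma>\<close> is added to both sides: after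
  normalisation this compares the characteristic functions of two probability measures.
\<close>
lemma gaussian_moments_determine_measure:
  assumes L: "real_distribution L" and int: "integrable L (\<lambda>x. exp (x\<^sup>2 / 4))"
    and mom: "\<And>k. (\<integral>x. x ^ k \<partial>L) = (\<integral>x. x ^ k * poly p x \<partial>std_gaussian)"
  shows "0 \<le> poly p x" and "L = density std_gaussian (\<lambda>x. ennreal (poly p x))"
proof -
  interpret L: real_distribution L by (rule L)
  interpret G: real_distribution std_gaussian by (rule real_distribution_std_gaussian)
  \<comment> \<open>Both \<open>r\<close> and \<open>s\<close> are at least 1 whatever the sign of
    p, because p^2 + p = ((2p + 1)^2 - 1)/4 \<ge> -1/4.\<close>
  define r where "r = [:2:] + p * p"
  define s where "s = p + r"
  define R where "R = gaussian_mass r"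
  have r: "1 \<le> poly r x" for x
    by (simp add: r_def)
  have s: "1 \<le> poly s x" for x
    using zero_le_power2[of "2 * poly p x + 1"] by (simp add: s_def r_def power2_eq_square algebra_simps)
  have poly_s: "poly s x = poly p x + poly r x" for x
    by (simp add: s_def)
  have R: "1 \<le> R"
    unfolding R_def by (rule gaussian_mass_ge_1) (rule r)
  \<comment> \<open>The moment of order 0: \<open>L\<close> has mass 1, hence so has p
    \<gamma>.\<close>
  have "gaussian_mass p = 1"
    using mom[of 0] L.prob_space by (simp add: gaussian_mass_def)
  then have mass_s: "gaussian_mass s = 1 + R"
    by (simp add: s_def R_def gaussian_mass_def)
  \<comment> \<open>\<open>L\<close> plus r \<gamma> has total mass 1 + R, so c and 1 - c are the
    normalised shares of the two summands.\<close>
  define c where "c = 1 / (1 + R)"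
  have c: "0 \<le> c" "c \<le> 1" "1 - c = R / (1 + R)"
    using R by (auto simp: c_def field_simps)
  note Dr = real_distribution_poly_gaussian[OF r] and Ds = real_distribution_poly_gaussian[OF s]
  have L_exp: "integrable L (\<lambda>x. exp (t * \<bar>x\<bar>))" for t
    using integrable_power_mult_exp_abs[OF L.events_eq_borel int, of 0 t] by simp
  have mom_eq: "c * (\<integral>x. x ^ k \<partial>L) + (1 - c) * (\<integral>x. x ^ k \<partial>poly_gaussian r)
      = (\<integral>x. x ^ k \<partial>poly_gaussian s)" for k
    using R c
    by (simp add: integral_poly_gaussian[OF r] integral_poly_gaussian[OF s] mom mass_s poly_s
        std_gaussian_integrable_power_mult_poly c_def distrib_left add_divide_distrib flip: R_def)
  have "char (mixture c L (poly_gaussian r)) t = char (poly_gaussian s) t" for t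
  proof -
    have "(\<lambda>k. c * ((\<i> * t) ^ k / fact k * (\<integral>x. x ^ k \<partial>L))
        + (1 - c) * ((\<i> * t) ^ k / fact k * (\<integral>x. x ^ k \<partial>poly_gaussian r)))
        sums (c * char L t + (1 - c) * char (poly_gaussian r) t)"
      by (intro sums_add sums_mult char_sums_moments L Dr L_exp integrable_poly_gaussian_exp_abs r)
    also have "(\<lambda>k. c * ((\<i> * t) ^ k / fact k * (\<integral>x. x ^ k \<partial>L))
        + (1 - c) * ((\<i> * t) ^ k / fact k * (\<integral>x. x ^ k \<partial>poly_gaussian r)))
        = (\<lambda>k. (\<i> * t) ^ k / fact k * (\<integral>x. x ^ k \<partial>poly_gaussian s))"
      unfolding mom_eq[symmetric] by (simp add: algebra_simps add_divide_distrib diff_divide_distrib)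
    finally have "(\<lambda>k. (\<i> * t) ^ k / fact k * (\<integral>x. x ^ k \<partial>poly_gaussian s))
        sums (c * char L t + (1 - c) * char (poly_gaussian r) t)" .
    moreover have "(\<lambda>k. (\<i> * t) ^ k / fact k * (\<integral>x. x ^ k \<partial>poly_gaussian s))
        sums char (poly_gaussian s) t"
      by (intro char_sums_moments Ds integrable_poly_gaussian_exp_abs s)
    ultimately show ?thesis
      using c char_mixture[OF _ _ L Dr, of c t] sums_unique2 by auto
  qed
  then have mix: "mixture c L (poly_gaussian r) = poly_gaussian s"
    by (intro Levy_uniqueness real_distribution_mixture c L Dr Ds ext)
  \<comment> \<open>On each Borel set the r-contributions to the two equal measures cancel, leaving
    the possibly signed p \<gamma>.\<close>
  have meas: "L.prob A = (\<integral>x. indicator A x * poly p x \<partial>std_gaussian)" if A: "A \<in> sets borel" for A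
  proof -
    have "(\<integral>x. indicator A x \<partial>mixture c L (poly_gaussian r)) = (\<integral>x. indicator A x \<partial>poly_gaussian s :: real)"
      by (simp add: mix)
    moreover have "(\<integral>x. indicator A x \<partial>mixture c L (poly_gaussian r))
        = c * L.prob A + (1 - c) * (\<integral>x. indicator A x \<partial>poly_gaussian r)"
      using A by (subst integral_mixture[OF c(1,2) L Dr, where B = 1]) (auto simp: indicator_def)
    ultimately have "c * L.prob A + (1 - c) * (\<integral>x. indicator A x \<partial>poly_gaussian r)
        = (\<integral>x. indicator A x \<partial>poly_gaussian s)"
      by simp
    also have "(\<integral>x. indicator A x \<partial>poly_gaussian r) = (\<integral>x. indicator A x * poly r x \<partial>std_gaussian) / R"
      unfolding R_def using A by (intro integral_poly_gaussian[OF r]) simp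
    also have "(\<integral>x. indicator A x \<partial>poly_gaussian s)
        = (\<integral>x. indicator A x * poly s x \<partial>std_gaussian) / (1 + R)"
      unfolding mass_s[symmetric] using A by (intro integral_poly_gaussian[OF s]) simp
    also have "(\<integral>x. indicator A x * poly s x \<partial>std_gaussian)
        = (\<integral>x. indicator A x * poly p x \<partial>std_gaussian) + (\<integral>x. indicator A x * poly r x \<partial>std_gaussian)"
      using std_gaussian_integrable_indicator_mult_poly[OF A] by (simp add: poly_s distrib_left)
    finally show ?thesis
      using R unfolding c(3) unfolding c_def by (simp add: add_divide_distrib)
  qed
  have "AE x in std_gaussian. 0 \<le> poly p x"
  proof -
    \<comment> \<open>\<open>L\<close> gives A nonnegative mass although p is negative on A; hence A
      is \<gamma>-null.\<close>
    define A where "A = {x. poly p x < 0}"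
    have A: "A \<in> sets borel"
      unfolding A_def by measurable
    have int_A: "integrable std_gaussian (\<lambda>x. - (indicator A x * poly p x))"
      by (intro Bochner_Integration.integrable_minus std_gaussian_integrable_indicator_mult_poly A)
    have nonneg: "0 \<le> - (indicator A x * poly p x)" for x
      by (auto simp: A_def indicator_def)
    have "0 \<le> (\<integral>x. indicator A x * poly p x \<partial>std_gaussian)"
      using meas[OF A] measure_nonneg[of L A] by simp
    moreover have "0 \<le> (\<integral>x. - (indicator A x * poly p x) \<partial>std_gaussian)"
      by (rule Bochner_Integration.integral_nonneg) (rule nonneg)
    ultimately have "(\<integral>x. - (indicator A x * poly p x) \<partial>std_gaussian) = 0"
      by simp
    then have "AE x in std_gaussian. - (indicator A x * poly p x) = 0"
      using integral_nonneg_eq_0_iff_AE[OF int_A] nonneg by simp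
    then show ?thesis
      by (rule AE_mp) (auto simp: A_def indicator_def)
  qed
  then show nonneg: "0 \<le> poly p x" for x
    by (rule poly_nonneg_of_AE_std_gaussian)
  show "L = density std_gaussian (\<lambda>x. ennreal (poly p x))"
  proof (rule measure_eqI)
    fix A assume "A \<in> sets L"
    then have A: "A \<in> sets borel" by simp
    have "emeasure L A = ennreal (\<integral>x. indicator A x * poly p x \<partial>std_gaussian)"
      by (simp add: L.emeasure_eq_measure meas[OF A])
    also have "\<dots> = (\<integral>\<^sup>+x. ennreal (indicator A x * poly p x) \<partial>std_gaussian)"
      by (intro nn_integral_eq_integral[symmetric] std_gaussian_integrable_indicator_mult_poly A)
         (auto simp: nonneg)
    also have "\<dots> = emeasure (density std_gaussian (\<lambda>x. ennreal (poly p x))) A"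
      using A by (auto simp: emeasure_density indicator_def intro!: nn_integral_cong)
    finally show "emeasure L A = emeasure (density std_gaussian (\<lambda>x. ennreal (poly p x))) A" .
  qed simp
qed


section \<open>Gaussian moments and Hermite tilts\<close>

definition gaussian_moment :: "nat \<Rightarrow> real" where
  "gaussian_moment k = (\<integral>x. x ^ k \<partial>std_gaussian)"

lemma gaussian_moment_eq:
  "gaussian_moment k = (if even k then fact k / (2 ^ (k div 2) * fact (k div 2)) else 0)"
proof -
  have "gaussian_moment k = (\<integral>x. std_normal_density x * x ^ k \<partial>lborel)"
    unfolding gaussian_moment_def std_gaussian_def by (subst integral_density) auto
  then show ?thesis
    using integral_std_normal_moment_even[of "k div 2"] integral_std_normal_moment_odd[of "k div 2"]
    by (cases "even k") auto
qed

lemma gaussian_moment_0 [simp]: "gaussian_moment 0 = 1"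
  and gaussian_moment_1 [simp]: "gaussian_moment (Suc 0) = 0"
  by (simp_all add: gaussian_moment_eq)

text \<open>In the closed form for even orders the common factor 2(b + 1) cancels. As a rewrite rule
  this reduces shifted moments to those of orders k and k + 1.\<close>

lemma gaussian_moment_Suc_Suc [simp]:
  "gaussian_moment (Suc (Suc k)) = (real k + 1) * gaussian_moment k"
proof (cases "even k")
  case True
  then obtain b where k: "k = 2 * b" ..
  have "fact (Suc (Suc (2 * b))) / (2 ^ Suc b * fact (Suc b))
      = (2 * (real b + 1)) * (real (2 * b) + 1) * fact (2 * b) / ((2 * (real b + 1)) * (2 ^ b * fact b))"
    by (simp add: algebra_simps)
  also have "\<dots> = (real (2 * b) + 1) * (fact (2 * b) / (2 ^ b * fact b))"
    by (subst mult.assoc, subst mult_divide_mult_cancel_left) auto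
  finally show ?thesis
    by (simp add: gaussian_moment_eq k)
qed (simp add: gaussian_moment_eq)

text \<open>The polynomial \<open>1 + e h\<^sub>1 + c h\<^sub>2 + d h\<^sub>3\<close> in the Hermite basis.\<close>
definition hermite_tilt :: "real \<Rightarrow> real \<Rightarrow> real \<Rightarrow> real poly" where
  "hermite_tilt e c d = [:1 - c, e - 3 * d, c, d:]"

lemma poly_hermite_tilt: "poly (hermite_tilt e c d) x = 1 + e * x + c * h2 x + d * (x ^ 3 - 3 * x)"
  by (simp add: hermite_tilt_def h2_def power2_eq_square power3_eq_cube algebra_simps)

text \<open>The k-th moment of (1 + e h_1 + c h_2 + d h_3) \<gamma> with higher Gaussian moments
  eliminated: h_2 contributes k times the k-th, h_3 contributes k - 1 times the (k+1)-st.\<close>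

definition tilted_moment :: "real \<Rightarrow> real \<Rightarrow> real \<Rightarrow> nat \<Rightarrow> real" where
  "tilted_moment e c d k =
     gaussian_moment k * (1 + c * k) + (e + d * (real k - 1)) * gaussian_moment (Suc k)"

lemma integral_power_mult_hermite_tilt:
  "(\<integral>x. x ^ k * poly (hermite_tilt e c d) x \<partial>std_gaussian) = tilted_moment e c d k"
proof -
  have int: "integrable std_gaussian (\<lambda>x. x ^ n)" for n
    by (intro integrable_power integrable_std_gaussian_exp_square) simp
  have "(\<lambda>x. x ^ k * poly (hermite_tilt e c d) x) = (\<lambda>x. (1 - c) * x ^ k + (e - 3 * d) * x ^ Suc k
      + c * x ^ Suc (Suc k) + d * x ^ Suc (Suc (Suc k)))"
    by (simp add: fun_eq_iff hermite_tilt_def algebra_simps)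
  then have "(\<integral>x. x ^ k * poly (hermite_tilt e c d) x \<partial>std_gaussian)
      = (1 - c) * gaussian_moment k + (e - 3 * d) * gaussian_moment (Suc k)
      + c * gaussian_moment (Suc (Suc k)) + d * gaussian_moment (Suc (Suc (Suc k)))"
    using int[of k] int[of "Suc k"] int[of "Suc (Suc k)"] int[of "Suc (Suc (Suc k))"]
    by (simp add: gaussian_moment_def del: power_Suc gaussian_moment_Suc_Suc)
  then show ?thesis
    by (simp add: tilted_moment_def algebra_simps)
qed

section \<open>The moment recursion and its solutions\<close>

text \<open>L is symmetric under \<gamma> and L h_n = -n h_n, so the coefficient a_n(y) of h_n at
  level y must satisfy y a_n(y - 1) = (y - n) a_n(y). The assumptions are these relations for n = 2,
  1, 3 when the level below has no h_1 or h_3 component.\<close>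

lemma tilted_moment_recursion:
  assumes "y * c' = (y - 2) * c" "(y - 1) * e = 0" "(y - 3) * d = 0"
  shows "y * (tilted_moment 0 c' 0 k - tilted_moment e c d k)
    = real k * (real k - 1) * tilted_moment e c d (k - 2) - real k * tilted_moment e c d k"
proof -
  \<comment> \<open>For k < 2 the subtraction k - 2 is truncated, but the factor k (k - 1)
    vanishes.\<close>
  consider "k = 0" | "k = 1" | j where "k = Suc (Suc j)"
    by (metis One_nat_def not0_implies_Suc)
  then show ?thesis
  proof cases
    case 3
    define g where "g = gaussian_moment j"
    define g' where "g' = gaussian_moment (Suc j)"
    \<comment> \<open>The defect of the recursion is a combination of the three assumptions with
      Gaussian moments in the coefficients.\<close>
    have "y * (tilted_moment 0 c' 0 k - tilted_moment e c d k)
        - (real k * (real k - 1) * tilted_moment e c d (k - 2) - real k * tilted_moment e c d k)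
      = (real j + 1) * (real j + 2) * g * (y * c' - (y - 2) * c)
        - (real j + 2) * g' * ((y - 1) * e) - (real j + 1) * (real j + 2) * g' * ((y - 3) * d)"
      unfolding 3 tilted_moment_def by (simp add: algebra_simps flip: g_def g'_def)
    then show ?thesis
      using assms by simp
  qed (use assms in \<open>auto simp: tilted_moment_def\<close>)
qed

text \<open>Subtracting the recursions cancels \<open>v\<close>; by induction the terms at k - 2
  agree, leaving (k - y) (u k - w k) = 0, which is silent only at k = y.\<close>

lemma moment_recursion_unique:
  fixes u v w :: "nat \<Rightarrow> real"
  assumes u: "\<And>k. real y * (v k - u k) = real k * (real k - 1) * u (k - 2) - real k * u k"
    and w: "\<And>k. real y * (v k - w k) = real k * (real k - 1) * w (k - 2) - real k * w k"
    and "u y = w y"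
  shows "u k = w k"
proof (induction k rule: less_induct)
  case (less k)
  show ?case
  proof (cases "k = y")
    case False
    \<comment> \<open>At k = 0 the truncated k - 2 is not smaller than k, so the induction
      hypothesis is replaced by the vanishing factor k.\<close>
    have "real k * (real k - 1) * u (k - 2) = real k * (real k - 1) * w (k - 2)"
      using less[of "k - 2"] by (cases "k = 0") auto
    with u[of k] w[of k] have "(real k - real y) * (u k - w k) = 0"
      by (simp add: algebra_simps)
    with False show ?thesis by simp
  qed (use \<open>u y = w y\<close> in simp)
qed

section \<open>The intertwining relation in terms of moments\<close>

definition OU_poly :: "real poly \<Rightarrow> real poly" where
  "OU_poly f = pderiv (pderiv f) - [:0, 1:] * pderiv f"

lemma OU_operator_poly: "OU_operator (poly f) = poly (OU_poly f)"
proof -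
  have "deriv (poly g) = poly (pderiv g)" for g :: "real poly"
    by (intro ext DERIV_imp_deriv poly_DERIV)
  then show ?thesis
    by (intro ext) (simp add: OU_operator_def OU_poly_def)
qed

lemma OU_poly_add: "OU_poly (f + g) = OU_poly f + OU_poly g"
  by (simp add: OU_poly_def pderiv_add algebra_simps)

lemma poly_OU_poly_monom:
  "poly (OU_poly (monom a k)) x = a * (real k * (real k - 1) * x ^ (k - 2) - real k * x ^ k)"
proof -
  consider "k = 0" | "k = 1" | j where "k = Suc (Suc j)"
    by (metis One_nat_def not0_implies_Suc)
  then show ?thesis
    by cases (simp_all add: OU_poly_def pderiv_monom poly_monom algebra_simps)
qed

lemma kernels_K_D:
  assumes "\<Lambda> \<in> kernels_K N" "y \<le> N"
  shows "real_distribution (\<Lambda> y)" "sets (\<Lambda> y) = sets borel"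
    and "integrable (\<Lambda> y) (\<lambda>x. exp (x\<^sup>2 / 4))"
proof -
  have "prob_space (\<Lambda> y)" and sets [measurable_cong]: "sets (\<Lambda> y) = sets borel"
    and fin: "(\<integral>\<^sup>+ x. ennreal (exp (x\<^sup>2 / 4)) \<partial>\<Lambda> y) < \<infinity>"
    using assms by (auto simp: kernels_K_def markov_kernels_def PiE_iff)
  then show "real_distribution (\<Lambda> y)" "sets (\<Lambda> y) = sets borel"
    by (auto simp: real_distribution_def real_distribution_axioms_def)
  show "integrable (\<Lambda> y) (\<lambda>x. exp (x\<^sup>2 / 4))"
    by (rule integrableI_bounded) (use fin in \<open>auto intro!: borel_measurable_continuous_onI\<close>)
qed

text \<open>Both sides of the intertwining relation are linear in f and polynomials are integrable,
  so testing on monomials suffices. At y = 0 the truncated y - 1 is multiplied by 0.\<close>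

lemma kernels_L_iff_moments:
  assumes K: "\<Lambda> \<in> kernels_K N"
  shows "\<Lambda> \<in> kernels_L N \<longleftrightarrow> (\<forall>y\<le>N. \<forall>k.
    real y * ((\<integral>x. x ^ k \<partial>\<Lambda> (y - 1)) - (\<integral>x. x ^ k \<partial>\<Lambda> y))
      = real k * (real k - 1) * (\<integral>x. x ^ (k - 2) \<partial>\<Lambda> y) - real k * (\<integral>x. x ^ k \<partial>\<Lambda> y))"
    (is "_ \<longleftrightarrow> (\<forall>y\<le>N. \<forall>k. ?rec y k)")
proof -
  define E where "E y f = (\<integral>x. poly f x \<partial>\<Lambda> y)" for y and f :: "real poly"
  define P where "P y f \<longleftrightarrow> real y * (E (y - 1) f - E y f) = E y (OU_poly f)" for y f
  have int: "integrable (\<Lambda> y) (\<lambda>x. poly f x)" if "y \<le> N" for y f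
    using kernels_K_D[OF K that] by (intro integrable_poly)
  have int_power: "integrable (\<Lambda> y) (\<lambda>x. x ^ k)" if "y \<le> N" for y k
    using kernels_K_D[OF K that] by (intro integrable_power)
  \<comment> \<open>Extensionality turns equality of functions on {0..N} into one equation for each
    y \<le> N.\<close>
  have L_iff: "\<Lambda> \<in> kernels_L N \<longleftrightarrow> (\<forall>f. \<forall>y\<le>N. P y f)"
    using K by (auto simp: kernels_L_def polynomial_functions_def OU_operator_poly yule_generator_def
        kernel_op_def restrict_def fun_eq_iff P_def E_def)
  have P_monom: "P y (monom a k)" if "y \<le> N" "?rec y k" for y a k
  proof -
    have "E y (OU_poly (monom a k)) =
        a * (real k * (real k - 1) * (\<integral>x. x ^ (k - 2) \<partial>\<Lambda> y) - real k * (\<integral>x. x ^ k \<partial>\<Lambda> y))"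
      using int_power[OF \<open>y \<le> N\<close>] by (simp add: E_def poly_OU_poly_monom)
    moreover have "E z (monom a k) = a * (\<integral>x. x ^ k \<partial>\<Lambda> z)" for z
      by (simp add: E_def poly_monom)
    ultimately show ?thesis
      using \<open>?rec y k\<close> by (simp add: P_def flip: right_diff_distrib)
  qed
  have P_monom_1: "P y (monom 1 k) \<longleftrightarrow> ?rec y k" if "y \<le> N" for y k
    using int_power[OF that] by (simp add: P_def E_def poly_OU_poly_monom poly_monom)
  have P_add: "P y (f + g)" if "y \<le> N" "P y f" "P y g" for y f g
  proof -
    \<comment> \<open>Applied at z = y and at z = y - 1, which is again at most N.\<close>
    have "E z (f + g) = E z f + E z g" if "z \<le> N" for z f g
      using int[OF that] by (simp add: E_def)
    then show ?thesis
      using that by (simp add: P_def OU_poly_add algebra_simps)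
  qed
  have "P y f" if "y \<le> N" "\<And>k. ?rec y k" for y f
  proof -
    have monom: "P y (monom a k)" for a k
      using P_monom that by blast
    \<comment> \<open>A polynomial is the sum of its monomials; induction runs over the partial
      sums.\<close>
    have "P y (\<Sum>i\<le>n. monom (coeff f i) i)" for n
      by (induction n) (simp_all add: P_add[OF that(1)] monom)
    then show ?thesis
      by (metis poly_as_sum_of_monoms)
  qed
  then show ?thesis
    using L_iff P_monom_1 by blast
qed

section \<open>Tilted Gaussians and the constraints from nonnegativity\<close>

lemma integral_power_density_hermite_tilt:
  assumes "\<And>x. 0 \<le> poly (hermite_tilt e c d) x"
  shows "(\<integral>x. x ^ k \<partial>density std_gaussian (\<lambda>x. ennreal (poly (hermite_tilt e c d) x))) = tilted_moment e c d k"
  by (subst integral_density) (use assms in \<open>auto simp: mult.commute simp flip: integral_power_mult_hermite_tilt\<close>)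

lemma h2_tilted_gaussian_eq:
  "h2_tilted_gaussian c = density std_gaussian (\<lambda>x. ennreal (poly (hermite_tilt 0 c 0) x))"
  by (simp add: h2_tilted_gaussian_def poly_hermite_tilt)

text \<open>Lets levels carrying \<gamma> itself be treated as tilts with coefficient 0.\<close>

lemma h2_tilted_gaussian_0: "h2_tilted_gaussian 0 = std_gaussian"
  by (simp add: h2_tilted_gaussian_def density_1)

lemma density_hermite_tilt_0:
  "density std_gaussian (\<lambda>x. ennreal (poly (hermite_tilt 0 0 0) x)) = std_gaussian"
  by (simp add: h2_tilted_gaussian_0 flip: h2_tilted_gaussian_eq)

lemma hermite_tilt_nonneg:
  assumes "0 \<le> c" "c \<le> 1"
  shows "0 \<le> poly (hermite_tilt 0 c 0) x"
proof -
  have "0 \<le> (1 - c) + c * x\<^sup>2"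
    using assms by simp
  then show ?thesis
    by (simp add: poly_hermite_tilt h2_def algebra_simps)
qed

lemma integral_power_h2_tilted_gaussian:
  assumes "0 \<le> c" "c \<le> 1"
  shows "(\<integral>x. x ^ k \<partial>h2_tilted_gaussian c) = tilted_moment 0 c 0 k"
  unfolding h2_tilted_gaussian_eq
  using assms by (intro integral_power_density_hermite_tilt hermite_tilt_nonneg)

text \<open>For nonzero e the value at \<open>- 2 / e\<close> would be -1.\<close>

lemma hermite_tilt_nonneg_imp_linear_0:
  assumes "\<And>x. 0 \<le> poly (hermite_tilt e 0 0) x"
  shows "e = 0"
  using assms[of "- 2 / e"] by (cases "e = 0") (simp_all add: poly_hermite_tilt)

lemma hermite_tilt_nonneg_imp_quadratic_bounds:
  assumes "\<And>x. 0 \<le> poly (hermite_tilt 0 c 0) x"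
  shows "0 \<le> c" "c \<le> 1"
proof -
  show "c \<le> 1"
    using assms[of 0] by (simp add: poly_hermite_tilt h2_def)
  show "0 \<le> c"
  proof (rule ccontr)
    assume "\<not> 0 \<le> c"
    \<comment> \<open>For c < 0 this point is chosen so that c h_2 = -2, giving the value
      -1.\<close>
    then have "h2 (sqrt (1 - 2 / c)) = - 2 / c"
      by (simp add: h2_def field_simps)
    with assms[of "sqrt (1 - 2 / c)"] \<open>\<not> 0 \<le> c\<close> show False
      by (simp add: poly_hermite_tilt)
  qed
qed

lemma hermite_tilt_nonneg_imp_cubic_0:
  assumes "\<And>x. 0 \<le> poly (hermite_tilt 0 c d) x"
  shows "d = 0"
proof (rule ccontr)
  assume "d \<noteq> 0"
  \<comment> \<open>As h_3 is odd, this is the value at -t if d > 0 and at t if d < 0; the cubic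
    term drives it to minus infinity.\<close>
  then have "filterlim (\<lambda>t. 1 + c * (t\<^sup>2 - 1) - \<bar>d\<bar> * (t ^ 3 - 3 * t)) at_bot at_top"
    by real_asymp
  then have "\<forall>\<^sub>F t in at_top. 1 + c * (t\<^sup>2 - 1) - \<bar>d\<bar> * (t ^ 3 - 3 * t) < 0"
    unfolding filterlim_at_bot_dense by blast
  then obtain t where "1 + c * (t\<^sup>2 - 1) - \<bar>d\<bar> * (t ^ 3 - 3 * t) < 0"
    using eventually_happens'[OF trivial_limit_at_top_linorder] by blast
  then show False
    using assms[of t] assms[of "- t"]
    by (auto simp: poly_hermite_tilt h2_def abs_if algebra_simps split: if_splits)
qed

section \<open>Determining the kernel level by level\<close>

text \<open>One step up from level y - 1. \<open>coeffs\<close> are the relations between Hermite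
  coefficients; the parameter they leave open (e at y = 1, c at y = 2, d at y = 3) is fitted to the
  y-th moment by \<open>free\<close>. Moment determinacy then identifies \<open>\<Lambda> y\<close>
  and makes its density nonnegative.\<close>

lemma kernels_L_step:
  assumes L: "\<Lambda> \<in> kernels_L N" and "y \<le> N"
    and prev: "y \<noteq> 0 \<Longrightarrow> \<Lambda> (y - 1) = h2_tilted_gaussian c'" "0 \<le> c'" "c' \<le> 1"
    and coeffs: "y * c' = (real y - 2) * c" "(real y - 1) * e = 0" "(real y - 3) * d = 0"
    and free: "(\<integral>x. x ^ y \<partial>\<Lambda> y) = tilted_moment e c d y"
  shows "0 \<le> poly (hermite_tilt e c d) x"
    and "\<Lambda> y = density std_gaussian (\<lambda>x. ennreal (poly (hermite_tilt e c d) x))"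
proof -
  have K: "\<Lambda> \<in> kernels_K N"
    using L by (simp add: kernels_L_def)
  have "(\<integral>x. x ^ k \<partial>\<Lambda> y) = tilted_moment e c d k" for k
  proof (rule moment_recursion_unique[where v = "tilted_moment 0 c' 0"])
    fix k
    show "real y * (tilted_moment 0 c' 0 k - tilted_moment e c d k)
        = real k * (real k - 1) * tilted_moment e c d (k - 2) - real k * tilted_moment e c d k"
      by (rule tilted_moment_recursion) (use coeffs in auto)
    \<comment> \<open>At y = 0 there is no level below, but both sides are 0.\<close>
    have prev_mom: "real y * (\<integral>x. x ^ k \<partial>\<Lambda> (y - 1)) = real y * tilted_moment 0 c' 0 k"
      using prev integral_power_h2_tilted_gaussian by (cases "y = 0") auto
    have "real y * ((\<integral>x. x ^ k \<partial>\<Lambda> (y - 1)) - (\<integral>x. x ^ k \<partial>\<Lambda> y))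
        = real k * (real k - 1) * (\<integral>x. x ^ (k - 2) \<partial>\<Lambda> y) - real k * (\<integral>x. x ^ k \<partial>\<Lambda> y)"
      using L \<open>y \<le> N\<close> unfolding kernels_L_iff_moments[OF K] by blast
    then show "real y * (tilted_moment 0 c' 0 k - (\<integral>x. x ^ k \<partial>\<Lambda> y))
        = real k * (real k - 1) * (\<integral>x. x ^ (k - 2) \<partial>\<Lambda> y) - real k * (\<integral>x. x ^ k \<partial>\<Lambda> y)"
      by (simp only: right_diff_distrib[of "real y"] prev_mom)
  qed (rule free)
  then have mom: "(\<integral>x. x ^ k \<partial>\<Lambda> y) = (\<integral>x. x ^ k * poly (hermite_tilt e c d) x \<partial>std_gaussian)" for k
    by (simp add: integral_power_mult_hermite_tilt)
  show "0 \<le> poly (hermite_tilt e c d) x"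
    and "\<Lambda> y = density std_gaussian (\<lambda>x. ennreal (poly (hermite_tilt e c d) x))"
    using gaussian_moments_determine_measure[OF kernels_K_D(1,3)[OF K \<open>y \<le> N\<close>] mom] by auto
qed

lemma kernels_L_0:
  assumes "\<Lambda> \<in> kernels_L N"
  shows "\<Lambda> 0 = std_gaussian"
proof -
  interpret real_distribution "\<Lambda> 0"
    using assms kernels_K_D(1)[of \<Lambda> N 0] by (simp add: kernels_L_def)
  \<comment> \<open>At y = 0 the moment in \<open>free\<close> is the total mass 1.\<close>
  show ?thesis
    using kernels_L_step(2)[OF assms, of 0 0 0 0 0] prob_space
    by (simp add: tilted_moment_def density_hermite_tilt_0)
qed

lemma kernels_L_1:
  assumes "\<Lambda> \<in> kernels_L N" "1 \<le> N"
  shows "\<Lambda> 1 = std_gaussian"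
proof -
  \<comment> \<open>At y = 1 the free value is the mean; nonnegativity of 1 + a x forces it to
    vanish.\<close>
  define a where "a = (\<integral>x. x \<partial>\<Lambda> 1)"
  note step = kernels_L_step[OF assms, where c' = 0 and c = 0 and e = a and d = 0]
  have prems: "\<Lambda> (1 - 1) = h2_tilted_gaussian 0" "(\<integral>x. x ^ 1 \<partial>\<Lambda> 1) = tilted_moment a 0 0 1"
    using kernels_L_0[OF assms(1)] by (simp_all add: h2_tilted_gaussian_0 a_def tilted_moment_def)
  have "a = 0"
    by (rule hermite_tilt_nonneg_imp_linear_0) (rule step(1), use prems in auto)
  with step(2) prems show ?thesis
    by (simp add: density_hermite_tilt_0)
qed

lemma kernels_L_2:
  assumes "\<Lambda> \<in> kernels_L N" "2 \<le> N"
  obtains c where "0 \<le> c" "c \<le> 1" "\<Lambda> 2 = h2_tilted_gaussian c"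
proof -
  \<comment> \<open>Solves 1 + 2c = second moment.\<close>
  define c where "c = ((\<integral>x. x ^ 2 \<partial>\<Lambda> 2) - 1) / 2"
  note step = kernels_L_step[OF assms, where c' = 0 and c = c and e = 0 and d = 0]
  have prems: "\<Lambda> (2 - 1) = h2_tilted_gaussian 0" "(\<integral>x. x ^ 2 \<partial>\<Lambda> 2) = tilted_moment 0 c 0 2"
    using kernels_L_1[OF assms(1)] assms(2)
    by (simp_all add: h2_tilted_gaussian_0 c_def tilted_moment_def numeral_2_eq_2 field_simps)
  have "0 \<le> poly (hermite_tilt 0 c 0) x" for x
    by (rule step(1)) (use prems in auto)
  moreover have "\<Lambda> 2 = h2_tilted_gaussian c"
    unfolding h2_tilted_gaussian_eq by (rule step(2)) (use prems in auto)
  ultimately show ?thesis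
    using that hermite_tilt_nonneg_imp_quadratic_bounds by blast
qed

lemma kernels_L_3:
  assumes "\<Lambda> \<in> kernels_L N" "3 \<le> N"
  obtains c where "0 \<le> c" "3 * c \<le> 1" "\<Lambda> 2 = h2_tilted_gaussian c" "\<Lambda> 3 = h2_tilted_gaussian (3 * c)"
proof -
  obtain c where c: "0 \<le> c" "c \<le> 1" "\<Lambda> 2 = h2_tilted_gaussian c"
    using kernels_L_2[of \<Lambda> N] assms by auto
  \<comment> \<open>The Gaussian moments of orders 3 and 4 are 0 and 3, so the tilted third moment
    is 6d.\<close>
  define d where "d = (\<integral>x. x ^ 3 \<partial>\<Lambda> 3) / 6"
  \<comment> \<open>At y = 3 the h_2 relation makes the coefficient three times that of level
    2.\<close>
  note step = kernels_L_step[OF assms, where c' = c and c = "3 * c" and e = 0 and d = d]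
  have prev: "\<Lambda> (3 - 1) = h2_tilted_gaussian c"
    using c by simp
  have free: "(\<integral>x. x ^ 3 \<partial>\<Lambda> 3) = tilted_moment 0 (3 * c) d 3"
    by (simp add: d_def tilted_moment_def numeral_3_eq_3)
  have nonneg: "0 \<le> poly (hermite_tilt 0 (3 * c) d) x" for x
    by (rule step(1)) (use prev free c in auto)
  \<comment> \<open>Nonnegativity first removes h_3; what remains bounds 3c by 1, which tightens the
    bound on level 2 as well.\<close>
  then have "d = 0"
    by (rule hermite_tilt_nonneg_imp_cubic_0)
  have "\<Lambda> 3 = h2_tilted_gaussian (3 * c)"
    using step(2) prev free c \<open>d = 0\<close> by (simp add: h2_tilted_gaussian_eq)
  moreover have "3 * c \<le> 1"
    using nonneg hermite_tilt_nonneg_imp_quadratic_bounds(2) unfolding \<open>d = 0\<close> by blast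
  ultimately show ?thesis
    using that c by blast
qed

section \<open>The converse inclusion and the two classifications\<close>

text \<open>Without h_1 and h_3 components the moment recursion reduces to the h_2 relation
  \<open>rec\<close> between consecutive levels.\<close>

lemma tilted_gaussians_in_kernels_L:
  assumes K: "\<Lambda> \<in> kernels_K N"
    and tilt: "\<And>y. y \<le> N \<Longrightarrow> \<Lambda> y = h2_tilted_gaussian (c y)"
    and c: "\<And>y. y \<le> N \<Longrightarrow> 0 \<le> c y" "\<And>y. y \<le> N \<Longrightarrow> c y \<le> 1"
    and rec: "\<And>y. y \<le> N \<Longrightarrow> y * c (y - 1) = (real y - 2) * c y"
  shows "\<Lambda> \<in> kernels_L N"
  unfolding kernels_L_iff_moments[OF K]
proof (intro allI impI)
  fix y k assume y: "y \<le> N"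
  then have "(\<integral>x. x ^ k \<partial>\<Lambda> z) = tilted_moment 0 (c z) 0 k" if "z \<le> y" for z k
    using that c by (simp add: tilt integral_power_h2_tilted_gaussian)
  then show "real y * ((\<integral>x. x ^ k \<partial>\<Lambda> (y - 1)) - (\<integral>x. x ^ k \<partial>\<Lambda> y))
      = real k * (real k - 1) * (\<integral>x. x ^ (k - 2) \<partial>\<Lambda> y) - real k * (\<integral>x. x ^ k \<partial>\<Lambda> y)"
    using tilted_moment_recursion[of "real y" "c (y - 1)" "c y" 0 0 k] rec[OF y] by simp
qed

theorem lemma12:
  shows "kernels_L 2 =
           {\<Lambda> \<in> kernels_K 2. \<exists>a\<^sub>2\<in>{0..2::real}.
              \<Lambda> 0 = std_gaussian \<and> \<Lambda> 1 = std_gaussian \<and>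
              \<Lambda> 2 = h2_tilted_gaussian (a\<^sub>2 / 2)} \<and>
         kernels_L 3 =
           {\<Lambda> \<in> kernels_K 3. \<exists>a\<^sub>2\<in>{0..2/3::real}.
              \<Lambda> 0 = std_gaussian \<and> \<Lambda> 1 = std_gaussian \<and>
              \<Lambda> 2 = h2_tilted_gaussian (a\<^sub>2 / 2) \<and>
              \<Lambda> 3 = h2_tilted_gaussian (3 * a\<^sub>2 / 2)}"
proof (intro conjI set_eqI iffI)
  fix \<Lambda> assume L: "\<Lambda> \<in> kernels_L 2"
  then obtain c where "0 \<le> c" "c \<le> 1" "\<Lambda> 2 = h2_tilted_gaussian c"
    using kernels_L_2 by blast
  \<comment> \<open>The parameter is a = 2c, so c \<le> 1 becomes a \<le> 2.\<close>
  then have "\<exists>a\<in>{0..2}. \<Lambda> 2 = h2_tilted_gaussian (a / 2)"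
    by (intro bexI[of _ "2 * c"]) auto
  then show "\<Lambda> \<in> {\<Lambda> \<in> kernels_K 2. \<exists>a\<^sub>2\<in>{0..2::real}. \<Lambda> 0 = std_gaussian \<and> \<Lambda> 1 = std_gaussian \<and>
      \<Lambda> 2 = h2_tilted_gaussian (a\<^sub>2 / 2)}"
    using L kernels_L_0[OF L] kernels_L_1[OF L] by (auto simp: kernels_L_def)
next
  fix \<Lambda> assume L: "\<Lambda> \<in> kernels_L 3"
  then obtain c where "0 \<le> c" "3 * c \<le> 1" "\<Lambda> 2 = h2_tilted_gaussian c" "\<Lambda> 3 = h2_tilted_gaussian (3 * c)"
    using kernels_L_3 by blast
  then have "\<exists>a\<in>{0..2/3}. \<Lambda> 2 = h2_tilted_gaussian (a / 2) \<and> \<Lambda> 3 = h2_tilted_gaussian (3 * a / 2)"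
    by (intro bexI[of _ "2 * c"]) auto
  then show "\<Lambda> \<in> {\<Lambda> \<in> kernels_K 3. \<exists>a\<^sub>2\<in>{0..2/3::real}. \<Lambda> 0 = std_gaussian \<and> \<Lambda> 1 = std_gaussian \<and>
      \<Lambda> 2 = h2_tilted_gaussian (a\<^sub>2 / 2) \<and> \<Lambda> 3 = h2_tilted_gaussian (3 * a\<^sub>2 / 2)}"
    using L kernels_L_0[OF L] kernels_L_1[OF L] by (auto simp: kernels_L_def)
next
  fix \<Lambda> assume "\<Lambda> \<in> {\<Lambda> \<in> kernels_K 2. \<exists>a\<^sub>2\<in>{0..2::real}. \<Lambda> 0 = std_gaussian \<and> \<Lambda> 1 = std_gaussian \<and>
      \<Lambda> 2 = h2_tilted_gaussian (a\<^sub>2 / 2)}"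
  then obtain a where K: "\<Lambda> \<in> kernels_K 2" and a: "0 \<le> a" "a \<le> 2"
    and \<Lambda>: "\<Lambda> 0 = std_gaussian" "\<Lambda> 1 = std_gaussian" "\<Lambda> 2 = h2_tilted_gaussian (a / 2)"
    by auto
  \<comment> \<open>Coefficients 0, 0, a/2: at y = 2 the factor y - 2 leaves the last one
    free.\<close>
  show "\<Lambda> \<in> kernels_L 2"
    by (rule tilted_gaussians_in_kernels_L[OF K, where c = "(\<lambda>_. 0)(2 := a / 2)"])
       (use a \<Lambda> in \<open>auto simp: le_Suc_eq numeral_2_eq_2 h2_tilted_gaussian_0\<close>)
next
  fix \<Lambda> assume "\<Lambda> \<in> {\<Lambda> \<in> kernels_K 3. \<exists>a\<^sub>2\<in>{0..2/3::real}. \<Lambda> 0 = std_gaussian \<and> \<Lambda> 1 = std_gaussian \<and>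
      \<Lambda> 2 = h2_tilted_gaussian (a\<^sub>2 / 2) \<and> \<Lambda> 3 = h2_tilted_gaussian (3 * a\<^sub>2 / 2)}"
  then obtain a where K: "\<Lambda> \<in> kernels_K 3" and a: "0 \<le> a" "a \<le> 2 / 3"
    and \<Lambda>: "\<Lambda> 0 = std_gaussian" "\<Lambda> 1 = std_gaussian" "\<Lambda> 2 = h2_tilted_gaussian (a / 2)"
      "\<Lambda> 3 = h2_tilted_gaussian (3 * a / 2)"
    by auto
  \<comment> \<open>At y = 3 the relation forces the coefficient 3a/2, and a \<le> 2/3 keeps it at
    most 1.\<close>
  show "\<Lambda> \<in> kernels_L 3"
    by (rule tilted_gaussians_in_kernels_L[OF K, where c = "(\<lambda>_. 0)(2 := a / 2, 3 := 3 * a / 2)"])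
       (use a \<Lambda> in \<open>auto simp: le_Suc_eq numeral_2_eq_2 numeral_3_eq_3 h2_tilted_gaussian_0\<close>)
qed

end
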